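(* Assume that the function $F_\rho$ is bounded below on $X$. Then the successive convex approximation algorithm described in the context terminates in finitely many iterations, that is, there exists an integer $\hat t\ge0$ such that $$F_\rho(x^{\hat t})-F_\rho(x^{\hat t,j_0,\mathbf{j}})+\frac{\delta_{\hat t}^2}{2L_0}\le\eta,\qquad\forall j_0\in\mathcal{J}_{0,\epsilon}(x^{\hat t}),\ \forall\,\mathbf{j}\in\mathcal{J}_\epsilon(x^{\hat t}),$$ where $x^{\hat t}$ and $x^{\hat t,j_0,\mathbf{j}}$ are generated by the algorithm for all $j_0\in\mathcal{J}_{0,\epsilon}(x^{\hat t})$ and $\mathbf{j}\in\mathcal{J}_\epsilon(x^{\hat t})$. Moreover, for any $j_0\in\mathcal{J}_{0,\epsilon}(x^{\hat t})$ and $\mathbf{j}\in\mathcal{J}_\epsilon(x^{\hat t})$, it holds that $$F_\rho(x^{\hat t})\le Q_\rho(x;x^{\hat t},j_0,\mathbf{j})+\eta,\qquad\forall x\in X.$$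
   Context: Setting. Let $X\subseteq\mathbb{R}^n$ be closed and convex; let $\zeta_i$ ($i=0,\dots,I$) be convex and continuous on an open set $\mathcal{S}\supseteq X$; let $\phi_i$ and $\psi_{i,j}$ ($i=0,\dots,I$, $1\le j\le J_i$) be convex and continuously differentiable on $\mathcal{S}$, with $\|\nabla\phi_i(x)-\nabla\phi_i(y)\|\le L_i\|x-y\|$ for all $x,y\in X$, where $L_i\ge0$ and $L_0>0$; for $i\in\{1,\dots,I\}$ one takes $L_i=0$ if $\phi_i$ is affine. Let $\psi_i(x)=\max_{1\le j\le J_i}\psi_{i,j}(x)$ and $F(x)=\phi_0(x)+\zeta_0(x)-\psi_0(x)$. Write $[a]_+=\max\{a,0\}$ and $[a]_+^p=([a]_+)^p$. Index sets: $\mathcal{I}=\{1,\dots,I\}$, $\mathcal{J}_i=\{1,\dots,J_i\}$, $\mathcal{J}=\mathcal{J}_1\times\cdots\times\mathcal{J}_I$ with elements $\mathbf{j}=(j_1,\dots,j_I)$; for $\epsilon>0$, $\mathcal{J}_{0,\epsilon}(x)=\{j\in\mathcal{J}_0:\psi_0(x)\le\psi_{0,j}(x)+\epsilon\}$ and $\mathcal{J}_\epsilon(x)=\{(j_1,\dots,j_I)\in\mathcal{J}:\psi_i(x)\le\psi_{i,j_i}(x)+\epsilon\ \forall i\in\mathcal{I}\}$. Functions: fix $p\ge1$ and $\rho>0$. For $\bar x\in X$, $\ell_f(x;\bar x)=f(\bar x)+\nabla f(\bar x)^T(x-\bar x)$ for smooth $f$, $\hat\phi_i(x;\bar x)=\phi_i(\bar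 x)+\nabla\phi_i(\bar x)^T(x-\bar x)+\tfrac{L_i}{2}\|x-\bar x\|^2$, and $$F_\rho(x)=F(x)+\rho\sum_{i=1}^I[\phi_i(x)+\zeta_i(x)-\psi_i(x)]_+^p,$$ $$Q_\rho(x;\bar x,j_0,\mathbf{j})=\hat\phi_0(x;\bar x)+\zeta_0(x)-\ell_{\psi_{0,j_0}}(x;\bar x)+\rho\sum_{i=1}^I[\hat\phi_i(x;\bar x)+\zeta_i(x)-\ell_{\psi_{i,j_i}}(x;\bar x)]_+^p.$$ $\iota_X$ is the indicator function of $X$ ($0$ on $X$, $+\infty$ elsewhere), $\partial$ is the convex subdifferential with respect to $x$, and $\mathrm{dist}$ is the Euclidean distance to a set. Algorithm (successive convex approximation for $\min_{x\in X}F_\rho(x)$). Step 0. Input $x^0\in X$, $\eta>0$, $\epsilon>0$ and a sequence $\{\delta_t\}$ of nonnegative reals with $\sum_{t=0}^\infty\delta_t^2<\infty$. Set $\mathcal{B}^0=\emptyset$, $t=0$. Step 1. Choose $(j_0,\mathbf{j})\in(\mathcal{J}_{0,\epsilon}(x^t)\times\mathcal{J}_\epsilon(x^t))\setminus\mathcal{B}^t$ and find an approximate solution $x^{t,j_0,\mathbf{j}}\in X$ of $\min_{x\in X}Q_\rho(x;x^t,j_0,\mathbf{j})$ satisfying $\mathrm{dist}\big(0,\partial[Q_\rho(x;x^t,j_0,\mathbf{j})+\iota_X(x)]|_{x=x^{t,j_0,\mathbf{j}}}\big)\le\delta_t$. Step 2. If $F_\rho(x^t)-F_\rho(x^{t,j_0,\mathbf{j}})+\delta_t^2/(2L_0)>\eta$,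 set $x^{t+1}=x^{t,j_0,\mathbf{j}}$, $\mathcal{B}^{t+1}=\emptyset$, $t\leftarrow t+1$ and go to Step 1; otherwise set $\mathcal{B}^t\leftarrow\mathcal{B}^t\cup\{(j_0,\mathbf{j})\}$ and go to Step 3. Step 3. If $\mathcal{J}_{0,\epsilon}(x^t)\times\mathcal{J}_\epsilon(x^t)=\mathcal{B}^t$, stop; otherwise go to Step 1. *)

theory Defs
  imports "HOL-Analysis.Analysis"
begin

section \<open>Convex analysis\<close>

definition grad :: "('a::euclidean_space \<Rightarrow> real) \<Rightarrow> 'a \<Rightarrow> 'a" where
  "grad f x = (THE D. GDERIV f x :> D)"

definition cont_diff_on :: "'a::euclidean_space set \<Rightarrow> ('a \<Rightarrow> real) \<Rightarrow> bool" where
  "cont_diff_on S f \<longleftrightarrow> (\<forall>x\<in>S. \<exists>D. GDERIV f x :> D) \<and> continuous_on S (grad f)"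

text \<open>
  The library's \<open>convex_on S f\<close> includes \<open>convex S\<close>. The open set carrying the data of the problem
  is not assumed to be convex, so convexity of a function on it means that Jensen's inequality
  holds along every segment inside the set; for convex \<open>S\<close> this is \<open>convex_on S f\<close>.
\<close>

definition convex_fun_on :: "'a::euclidean_space set \<Rightarrow> ('a \<Rightarrow> real) \<Rightarrow> bool" where
  "convex_fun_on S f \<longleftrightarrow> (\<forall>x y. closed_segment x y \<subseteq> S \<longrightarrow> convex_on (closed_segment x y) f)"

lemma convex_fun_on_iff_convex_on:
  assumes "convex S"
  shows "convex_fun_on S f \<longleftrightarrow> convex_on S f"
proof
  assume f: "convex_fun_on S f"
  show "convex_on S f"
    unfolding convex_on_def
  proof (intro conjI ballI allI impI)
    fix x y u v :: _
    assume xy: "x \<in> S" "y \<in> S" and uv: "0 \<le> (u::real)" "0 \<le> v" "u + v = 1"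
    have "closed_segment x y \<subseteq> S"
      using assms xy by (simp add: closed_segment_subset)
    then have "convex_on (closed_segment x y) f"
      using f by (simp add: convex_fun_on_def)
    then show "f (u *\<^sub>R x + v *\<^sub>R y) \<le> u * f x + v * f y"
      using uv by (simp add: convex_on_def)
  qed (rule assms)
next
  assume "convex_on S f"
  then show "convex_fun_on S f"
    by (auto simp: convex_fun_on_def intro: convex_on_subset)
qed

definition indicator_fun :: "'a set \<Rightarrow> 'a \<Rightarrow> ereal" where
  "indicator_fun X x = (if x \<in> X then 0 else \<infinity>)"

definition subdifferential :: "('a::euclidean_space \<Rightarrow> ereal) \<Rightarrow> 'a \<Rightarrow> 'a set" where
  "subdifferential f x =
     {v. \<bar>f x\<bar> \<noteq> \<infinity> \<and> (\<forall>y. f x + ereal (v \<bullet> (y - x)) \<le> f y)}"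

section \<open>Problem data\<close>

record 'a dc_data =
  feas :: "'a set"                        (* X *)
  nbhd :: "'a set"                        (* the open set containing X *)
  ncon :: nat                             (* I; constraints are 1..I, the objective is 0 *)
  npsi :: "nat \<Rightarrow> nat"                    (* J_i *)
  phi  :: "nat \<Rightarrow> 'a \<Rightarrow> real"
  zeta :: "nat \<Rightarrow> 'a \<Rightarrow> real"
  psi  :: "nat \<Rightarrow> nat \<Rightarrow> 'a \<Rightarrow> real"       (* psi_{i,j}, 1 <= j <= J_i *)
  lip  :: "nat \<Rightarrow> real"                   (* L_i *)

definition psi_max :: "'a dc_data \<Rightarrow> nat \<Rightarrow> 'a \<Rightarrow> real" where
  "psi_max P i x = Max ((\<lambda>j. psi P i j x) ` {1..npsi P i})"

definition obj :: "'a dc_data \<Rightarrow> 'a \<Rightarrow> real" where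
  "obj P x = phi P 0 x + zeta P 0 x - psi_max P 0 x"

definition penalized :: "'a dc_data \<Rightarrow> real \<Rightarrow> real \<Rightarrow> 'a \<Rightarrow> real" where
  "penalized P p \<rho> x = obj P x +
     \<rho> * (\<Sum>i = 1..ncon P. max (phi P i x + zeta P i x - psi_max P i x) 0 powr p)"

definition lin :: "('a::euclidean_space \<Rightarrow> real) \<Rightarrow> 'a \<Rightarrow> 'a \<Rightarrow> real" where
  "lin f xb x = f xb + grad f xb \<bullet> (x - xb)"

definition phi_hat :: "('a::euclidean_space) dc_data \<Rightarrow> nat \<Rightarrow> 'a \<Rightarrow> 'a \<Rightarrow> real" where
  "phi_hat P i xb x =
     phi P i xb + grad (phi P i) xb \<bullet> (x - xb) + lip P i / 2 * (norm (x - xb))\<^sup>2"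

text \<open>The base point \<open>xb\<close> precedes the variable \<open>x\<close> in \<open>lin\<close>, \<open>phi_hat\<close> and \<open>model\<close>.\<close>

definition model ::
  "('a::euclidean_space) dc_data \<Rightarrow> real \<Rightarrow> real \<Rightarrow> 'a \<Rightarrow> nat \<times> (nat \<Rightarrow> nat) \<Rightarrow> 'a \<Rightarrow> real" where
  "model P p \<rho> xb = (\<lambda>(j0, j) x.
     phi_hat P 0 xb x + zeta P 0 x - lin (psi P 0 j0) xb x +
     \<rho> * (\<Sum>i = 1..ncon P.
            max (phi_hat P i xb x + zeta P i x - lin (psi P i (j i)) xb x) 0 powr p))"

definition J0_eps :: "'a dc_data \<Rightarrow> real \<Rightarrow> 'a \<Rightarrow> nat set" where
  "J0_eps P \<epsilon> x = {j \<in> {1..npsi P 0}. psi_max P 0 x \<le> psi P 0 j x + \<epsilon>}"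

text \<open>Multi-indices are functions on \<open>{1..ncon P}\<close>, extended by \<open>undefined\<close>.\<close>

definition J_eps :: "'a dc_data \<Rightarrow> real \<Rightarrow> 'a \<Rightarrow> (nat \<Rightarrow> nat) set" where
  "J_eps P \<epsilon> x = {j \<in> PiE {1..ncon P} (\<lambda>i. {1..npsi P i}).
                    \<forall>i \<in> {1..ncon P}. psi_max P i x \<le> psi P i (j i) x + \<epsilon>}"

section \<open>The algorithm\<close>

text \<open>
  Nonemptiness is required because \<open>infdist x {} = 0\<close>, whereas the distance to the empty set is
  infinite in the stopping criterion of the subproblem.
\<close>

definition approx_sol ::
  "('a::euclidean_space) dc_data \<Rightarrow> real \<Rightarrow> real \<Rightarrow> real \<Rightarrow> 'a \<Rightarrow> nat \<times> (nat \<Rightarrow> nat) \<Rightarrow> 'a \<Rightarrow> bool"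
where
  "approx_sol P p \<rho> d xb jj y \<longleftrightarrow> y \<in> feas P \<and>
     (let D = subdifferential (\<lambda>x. ereal (model P p \<rho> xb jj x) + indicator_fun (feas P) x) y
      in D \<noteq> {} \<and> infdist 0 D \<le> d)"

text \<open>
  A state consists of the counter \<open>t\<close>, the iterate \<open>x\<^sup>t\<close>, the set \<open>B\<^sup>t\<close> of index pairs tried and
  rejected so far at \<open>x\<^sup>t\<close>, and the rejected approximate solutions found at \<open>x\<^sup>t\<close>, indexed by
  these pairs.
\<close>

record 'a sca_state =
  counter :: nat
  point :: 'a
  tried :: "(nat \<times> (nat \<Rightarrow> nat)) set"
  trial :: "nat \<times> (nat \<Rightarrow> nat) \<rightharpoonup> 'a"

definition sca_init :: "'a \<Rightarrow> 'a sca_state" where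
  "sca_init x0 = \<lparr>counter = 0, point = x0, tried = {}, trial = Map.empty\<rparr>"

definition sca_stopped :: "'a dc_data \<Rightarrow> real \<Rightarrow> 'a sca_state \<Rightarrow> bool" where
  "sca_stopped P \<epsilon> s \<longleftrightarrow> J0_eps P \<epsilon> (point s) \<times> J_eps P \<epsilon> (point s) = tried s"

text \<open>One transition is one pass through Steps 1 and 2.\<close>

inductive sca_step ::
  "('a::euclidean_space) dc_data \<Rightarrow> real \<Rightarrow> real \<Rightarrow> real \<Rightarrow> real \<Rightarrow> (nat \<Rightarrow> real) \<Rightarrow>
   'a sca_state \<Rightarrow> 'a sca_state \<Rightarrow> bool"
  for P p \<rho> \<eta> \<epsilon> \<delta>
where
  accept:
    "\<lbrakk> jj \<in> (J0_eps P \<epsilon> x \<times> J_eps P \<epsilon> x) - B;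
       approx_sol P p \<rho> (\<delta> t) x jj y;
       penalized P p \<rho> x - penalized P p \<rho> y + (\<delta> t)\<^sup>2 / (2 * lip P 0) > \<eta> \<rbrakk>
     \<Longrightarrow> sca_step P p \<rho> \<eta> \<epsilon> \<delta>
          \<lparr>counter = t, point = x, tried = B, trial = T\<rparr>
          \<lparr>counter = Suc t, point = y, tried = {}, trial = Map.empty\<rparr>"
| reject:
    "\<lbrakk> jj \<in> (J0_eps P \<epsilon> x \<times> J_eps P \<epsilon> x) - B;
       approx_sol P p \<rho> (\<delta> t) x jj y;
       \<not> penalized P p \<rho> x - penalized P p \<rho> y + (\<delta> t)\<^sup>2 / (2 * lip P 0) > \<eta> \<rbrakk>
     \<Longrightarrow> sca_step P p \<rho> \<eta> \<epsilon> \<delta>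
          \<lparr>counter = t, point = x, tried = B, trial = T\<rparr>
          \<lparr>counter = t, point = x, tried = insert jj B, trial = T(jj \<mapsto> y)\<rparr>"

text \<open>
  An execution is an infinite sequence of states that is constant once the stopping test succeeds;
  if the test never succeeds, the algorithm runs forever.
\<close>

definition sca_execution ::
  "('a::euclidean_space) dc_data \<Rightarrow> real \<Rightarrow> real \<Rightarrow> real \<Rightarrow> real \<Rightarrow> (nat \<Rightarrow> real) \<Rightarrow> 'a \<Rightarrow>
   (nat \<Rightarrow> 'a sca_state) \<Rightarrow> bool"
where
  "sca_execution P p \<rho> \<eta> \<epsilon> \<delta> x0 \<sigma> \<longleftrightarrow> \<sigma> 0 = sca_init x0 \<and>
     (\<forall>k. if sca_stopped P \<epsilon> (\<sigma> k) then \<sigma> (Suc k) = \<sigma> k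
          else sca_step P p \<rho> \<eta> \<epsilon> \<delta> (\<sigma> k) (\<sigma> (Suc k)))"

end

theory Submission
  imports Defs
begin

text \<open>
  Each model \<open>Q\<close> built at a base point \<open>c\<close> lies above the penalized objective \<open>F\<close> on the
  feasible set: the smooth parts \<open>phi\<close> are replaced by the quadratic upper bounds of the descent
  lemma, the subtracted convex parts \<open>psi\<close> by tangents, which lie below them, and the penalty is
  monotone (\<open>penalized_le_model\<close>). Moreover \<open>Q\<close> minus the quadratic
  \<open>lip P 0 / 2 * (norm (x - c))\<^sup>2\<close> is convex (\<open>convex_on_model_minus_quadratic\<close>), so \<open>Q\<close> is
  strongly convex: at a feasible point \<open>y\<close> where the subdifferential of \<open>Q\<close> plus the indicator
  function comes within distance \<open>d\<close> of the origin, the value of \<open>Q\<close> exceeds its value at any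
  feasible point by at most \<open>d\<^sup>2 / (2 * lip P 0)\<close>
  (\<open>strongly_convex_inexact_minimizer\<close>).

  For the final estimate, let \<open>y\<close> be the rejected trial point for a given index pair, computed with
  tolerance \<open>d\<close> at the last iterate \<open>c\<close>. For every feasible \<open>x\<close>,
  \<open>F c \<le> F y + \<eta> - d\<^sup>2 / (2 * lip P 0) \<le> Q y + \<eta> - d\<^sup>2 / (2 * lip P 0) \<le> Q x + \<eta>\<close>:
  rejection gives the first inequality, majorization the second, and inexact minimality the third.
  The term in \<open>d\<close> in the acceptance test is exactly the one that inexact minimality costs.

  Termination is an energy argument. An accepted step changes \<open>F\<close> by less than
  \<open>d\<^sup>2 / (2 * lip P 0) - \<eta>\<close>; since the squared tolerances are summable and \<open>F\<close> is bounded below,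
  only a bounded number of steps can be accepted. Between two acceptances every pass consumes a new
  index pair, of which there are finitely many. Hence a lexicographic measure decreases along any
  run that does not stop (\<open>sca_execution_stops\<close>).
\<close>

section \<open>Tangents and descent\<close>

text \<open>
  The definite description in \<open>grad\<close> denotes the gradient wherever one exists, because two vectors
  representing the same derivative have the same inner product with every direction.
\<close>

lemma GDERIV_grad:
  assumes "cont_diff_on S f" "x \<in> S"
  shows "GDERIV f x :> grad f x"
proof -
  obtain D where D: "GDERIV f x :> D"
    using assms unfolding cont_diff_on_def by blast
  have "E = D" if "GDERIV f x :> E" for E
  proof -
    have "(\<lambda>h. h \<bullet> E) = (\<lambda>h. h \<bullet> D)"
      using that D unfolding gderiv_def by (rule has_derivative_unique)
    then have "h \<bullet> E = h \<bullet> D" for h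
      by meson
    then show ?thesis
      using vector_eq_ldot by blast
  qed
  with D show ?thesis
    unfolding grad_def by (rule theI)
qed

lemma DERIV_along_segment:
  fixes f :: "'a::euclidean_space \<Rightarrow> real"
  assumes "GDERIV f (x + t *\<^sub>R d) :> D"
  shows "DERIV (\<lambda>t. f (x + t *\<^sub>R d)) t :> D \<bullet> d"
proof -
  have "((\<lambda>t. x + t *\<^sub>R d) has_derivative (\<lambda>h. h *\<^sub>R d)) (at t)"
    by (auto intro!: derivative_eq_intros)
  from has_derivative_compose[OF this assms[unfolded gderiv_def]]
  show ?thesis
    unfolding has_field_derivative_def
    by (rule has_derivative_subst) (auto simp: inner_commute)
qed

text \<open>
  By Jensen's inequality the difference quotients along the segment from \<open>c\<close> to \<open>x\<close> are bounded by
  \<open>f x - f c\<close>, and they converge to the slope of the tangent. The limit is one-sided because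
  convexity is available only on the segment itself, of which \<open>c\<close> is an endpoint.
\<close>

lemma lin_le_of_convex_fun_on:
  fixes f :: "'a::euclidean_space \<Rightarrow> real"
  assumes f: "convex_fun_on S f" and "cont_diff_on S f"
    and seg: "closed_segment c x \<subseteq> S"
  shows "lin f c x \<le> f x"
proof -
  have cvx: "convex_on (closed_segment c x) f"
    using f seg by (simp add: convex_fun_on_def)
  have "c \<in> S"
    using seg by auto
  then have "GDERIV f (c + 0 *\<^sub>R (x - c)) :> grad f c"
    using assms GDERIV_grad by auto
  then have "DERIV (\<lambda>t. f (c + t *\<^sub>R (x - c))) 0 :> grad f c \<bullet> (x - c)"
    by (rule DERIV_along_segment)
  then have "((\<lambda>t. (f (c + t *\<^sub>R (x - c)) - f c) / t) \<longlongrightarrow> grad f c \<bullet> (x - c)) (at 0)"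
    by (simp add: DERIV_def)
  then have lim: "((\<lambda>t. (f (c + t *\<^sub>R (x - c)) - f c) / t) \<longlongrightarrow> grad f c \<bullet> (x - c)) (at_right 0)"
    by (rule filterlim_mono) (auto simp: at_within_le_at)
  have "(f (c + t *\<^sub>R (x - c)) - f c) / t \<le> f x - f c" if t: "0 < t" "t < 1" for t :: real
  proof -
    have "f ((1 - t) *\<^sub>R c + t *\<^sub>R x) \<le> (1 - t) * f c + t * f x"
      using t by (intro convex_onD[OF cvx]) auto
    moreover have "(1 - t) *\<^sub>R c + t *\<^sub>R x = c + t *\<^sub>R (x - c)"
      by (simp add: algebra_simps)
    ultimately show ?thesis
      using t by (simp add: field_simps)
  qed
  then have "\<forall>\<^sub>F t in at_right 0. (f (c + t *\<^sub>R (x - c)) - f c) / t \<le> f x - f c"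
    by (intro eventually_at_rightI[of 0 1]) auto
  from tendsto_upperbound[OF lim this] show ?thesis
    by (simp add: lin_def)
qed

text \<open>
  Along the segment from \<open>c\<close> to \<open>x\<close>, the gap between \<open>f\<close> and its quadratic upper bound has a
  nonpositive derivative by the Lipschitz estimate, which applies because the segment stays in \<open>X\<close>,
  and the Cauchy-Schwarz inequality.
\<close>

lemma descent_lemma:
  fixes f :: "'a::euclidean_space \<Rightarrow> real"
  assumes X: "convex X" "X \<subseteq> S" and f: "cont_diff_on S f"
    and lip: "\<And>x y. x \<in> X \<Longrightarrow> y \<in> X \<Longrightarrow> norm (grad f x - grad f y) \<le> L * norm (x - y)"
    and c: "c \<in> X" and x: "x \<in> X"
  shows "f x \<le> lin f c x + L / 2 * (norm (x - c))\<^sup>2"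
proof -
  define d where "d = x - c"
  define g where "g t = f (c + t *\<^sub>R d) - t * (grad f c \<bullet> d) - L / 2 * t\<^sup>2 * (norm d)\<^sup>2" for t
  have "\<exists>y. DERIV g t :> y \<and> y \<le> 0" if t: "0 \<le> t" "t \<le> 1" for t
  proof -
    have z: "c + t *\<^sub>R d \<in> X"
      using convexD_alt[OF X(1) c x t] by (simp add: d_def algebra_simps)
    with X f have "GDERIV f (c + t *\<^sub>R d) :> grad f (c + t *\<^sub>R d)"
      by (intro GDERIV_grad[of S]) auto
    from DERIV_along_segment[OF this]
    have "DERIV g t :> grad f (c + t *\<^sub>R d) \<bullet> d - grad f c \<bullet> d - L * t * (norm d)\<^sup>2"
      unfolding g_def by (auto intro!: derivative_eq_intros)
    moreover have "(grad f (c + t *\<^sub>R d) - grad f c) \<bullet> d \<le> L * t * (norm d)\<^sup>2"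
    proof -
      have "(grad f (c + t *\<^sub>R d) - grad f c) \<bullet> d \<le> norm (grad f (c + t *\<^sub>R d) - grad f c) * norm d"
        by (rule norm_cauchy_schwarz)
      also have "\<dots> \<le> (L * norm (c + t *\<^sub>R d - c)) * norm d"
        by (intro mult_right_mono lip z c) auto
      also have "\<dots> = L * t * (norm d)\<^sup>2"
        using t by (simp add: power2_eq_square)
      finally show ?thesis .
    qed
    ultimately show ?thesis
      by (auto simp: inner_diff_left)
  qed
  then have "g 1 \<le> g 0"
    by (rule DERIV_nonpos_imp_nonincreasing[OF zero_le_one])
  then show ?thesis
    by (simp add: g_def d_def lin_def)
qed

section \<open>Convexity tools\<close>

text \<open>
  Jensen's inequality for the squared norm with its exact defect \<open>u * v * (norm (a - b))\<^sup>2\<close>; the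
  defect is what strong convexity retains.
\<close>

lemma norm_convex_combination_squared:
  fixes a b :: "'a::real_inner" and u v :: real
  assumes "u + v = 1"
  shows "(norm (u *\<^sub>R a + v *\<^sub>R b))\<^sup>2
    = u * (norm a)\<^sup>2 + v * (norm b)\<^sup>2 - u * v * (norm (a - b))\<^sup>2"
proof -
  have v: "v = 1 - u"
    using assms by simp
  show ?thesis
    unfolding v power2_norm_eq_inner by (simp add: inner_simps inner_commute algebra_simps)
qed

lemma norm_diff_convex_combination_squared:
  fixes a b c :: "'a::real_inner" and u v :: real
  assumes "u + v = 1"
  shows "(norm (u *\<^sub>R a + v *\<^sub>R b - c))\<^sup>2
    = u * (norm (a - c))\<^sup>2 + v * (norm (b - c))\<^sup>2 - u * v * (norm (a - b))\<^sup>2"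
proof -
  have u: "u = 1 - v"
    using assms by simp
  have "u *\<^sub>R a + v *\<^sub>R b - c = u *\<^sub>R (a - c) + v *\<^sub>R (b - c)"
    unfolding u by (simp add: algebra_simps)
  then show ?thesis
    using norm_convex_combination_squared[OF assms, of "a - c" "b - c"] by simp
qed

lemma convex_on_norm_diff_squared:
  fixes c :: "'a::real_inner"
  assumes "convex X"
  shows "convex_on X (\<lambda>x. (norm (x - c))\<^sup>2)"
  unfolding convex_on_def
  using assms by (auto simp: norm_diff_convex_combination_squared)

lemma convex_on_inner_right:
  assumes "convex X"
  shows "convex_on X (\<lambda>x. v \<bullet> (x - c))"
  unfolding convex_on_def
proof (intro conjI ballI allI impI)
  fix x y and s t :: real
  assume "s + t = 1"
  then have s: "s = 1 - t"
    by simp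
  have "s *\<^sub>R x + t *\<^sub>R y - c = s *\<^sub>R (x - c) + t *\<^sub>R (y - c)"
    unfolding s by (simp add: algebra_simps)
  then show "v \<bullet> (s *\<^sub>R x + t *\<^sub>R y - c) \<le> s * (v \<bullet> (x - c)) + t * (v \<bullet> (y - c))"
    by (simp add: inner_add_right)
qed (rule assms)

lemma convex_on_sum_fun:
  assumes "convex X" "\<And>i. i \<in> A \<Longrightarrow> convex_on X (f i)"
  shows "convex_on X (\<lambda>x. \<Sum>i\<in>A. f i x)"
  using assms(2)
proof (induction A rule: infinite_finite_induct)
  case (insert i A)
  then show ?case
    by (auto intro!: convex_on_add)
qed (use assms(1) in \<open>auto simp: convex_on_const\<close>)

text \<open>
  An endpoint at \<open>0\<close> has to be included, since the positive part of a constraint function vanishes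
  wherever the constraint holds; there the claim reduces to \<open>t powr p \<le> t\<close> for \<open>0 < t < 1\<close>.
\<close>

lemma convex_on_powr_nonneg:
  assumes p: "p \<ge> 1"
  shows "convex_on {0..} (\<lambda>x::real. x powr p)"
proof (rule convex_on_linorderI)
  fix t x y :: real
  assume t: "0 < t" "t < 1" and xy: "x \<in> {0..}" "y \<in> {0..}" "x < y"
  show "((1 - t) *\<^sub>R x + t *\<^sub>R y) powr p \<le> (1 - t) * x powr p + t * y powr p"
  proof (cases "x = 0")
    case True
    have "t powr p \<le> t powr 1"
      using t p by (intro powr_mono') auto
    then have "t powr p * y powr p \<le> t * y powr p"
      using t by (intro mult_right_mono) auto
    then show ?thesis
      using True t xy p by (simp add: powr_mult)
  next
    case False
    then show ?thesis
      using t xy by (intro convex_onD[OF powr_convex[OF p]]) auto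
  qed
qed simp

lemma convex_on_pos_part_powr:
  assumes g: "convex_on X g" and p: "p \<ge> 1"
  shows "convex_on X (\<lambda>x. max (g x) 0 powr p)"
  unfolding convex_on_def
proof (intro conjI ballI allI impI)
  show "convex X"
    using g by (rule convex_on_imp_convex)
next
  fix x y and u v :: real
  assume xy: "x \<in> X" "y \<in> X" and uv: "0 \<le> u" "0 \<le> v" "u + v = 1"
  have "g (u *\<^sub>R x + v *\<^sub>R y) \<le> u * g x + v * g y"
    using g xy uv by (simp add: convex_on_def)
  also have "\<dots> \<le> u * max (g x) 0 + v * max (g y) 0"
    using uv by (intro add_mono mult_left_mono) auto
  finally have "max (g (u *\<^sub>R x + v *\<^sub>R y)) 0 \<le> u * max (g x) 0 + v * max (g y) 0"
    using uv by simp
  then have "max (g (u *\<^sub>R x + v *\<^sub>R y)) 0 powr p \<le> (u * max (g x) 0 + v * max (g y) 0) powr p"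
    using p by (intro powr_mono2) auto
  also have "\<dots> \<le> u * max (g x) 0 powr p + v * max (g y) 0 powr p"
    using convex_on_powr_nonneg[OF p] uv unfolding convex_on_def by simp
  finally show "max (g (u *\<^sub>R x + v *\<^sub>R y)) 0 powr p
    \<le> u * max (g x) 0 powr p + v * max (g y) 0 powr p" .
qed

section \<open>Approximate minimizers of strongly convex functions\<close>

text \<open>
  The subgradient inequality is applied at a point \<open>z\<close> moved from \<open>y\<close> by a fraction \<open>t\<close> of the way
  to \<open>x\<close>, and \<open>q z\<close> is bounded above by convexity of \<open>q\<close> minus the quadratic. The quadratic
  contributes its Jensen defect, of order \<open>t\<close>, so that dividing by \<open>t\<close> and letting \<open>t\<close> tend to
  \<open>0\<close> leaves the full modulus \<open>L / 2\<close>. This avoids splitting the subdifferential of the sum of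
  \<open>q\<close> and the indicator function.
\<close>

lemma strongly_convex_subgradient_bound:
  fixes q :: "'a::euclidean_space \<Rightarrow> real"
  assumes q: "convex_on X (\<lambda>x. q x - L / 2 * (norm (x - c))\<^sup>2)"
    and v: "v \<in> subdifferential (\<lambda>x. ereal (q x) + indicator_fun X x) y"
    and y: "y \<in> X" and x: "x \<in> X"
  shows "q y + v \<bullet> (x - y) + L / 2 * (norm (x - y))\<^sup>2 \<le> q x"
proof -
  have X: "convex X"
    using q by (rule convex_on_imp_convex)
  define H where "H = L / 2"
  have "q y + v \<bullet> (x - y) + H * (1 - t) * (norm (x - y))\<^sup>2 \<le> q x" if t: "0 < t" "t < 1" for t
  proof -
    define z where "z = (1 - t) *\<^sub>R y + t *\<^sub>R x"
    have "z \<in> X"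
      using convexD_alt[OF X y x] t by (simp add: z_def)
    with v y have "q y + v \<bullet> (z - y) \<le> q z"
      unfolding subdifferential_def indicator_fun_def by (auto dest: spec[of _ z])
    moreover have "v \<bullet> (z - y) = t * (v \<bullet> (x - y))"
    proof -
      have "z - y = t *\<^sub>R (x - y)"
        by (simp add: z_def algebra_simps)
      then show ?thesis
        by simp
    qed
    moreover have "q z - H * (norm (z - c))\<^sup>2
        \<le> (1 - t) * (q y - H * (norm (y - c))\<^sup>2) + t * (q x - H * (norm (x - c))\<^sup>2)"
      unfolding z_def H_def using t by (intro convex_onD[OF q] x y) auto
    moreover have "(norm (z - c))\<^sup>2
        = (1 - t) * (norm (y - c))\<^sup>2 + t * (norm (x - c))\<^sup>2 - (1 - t) * t * (norm (x - y))\<^sup>2"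
      unfolding z_def by (subst norm_diff_convex_combination_squared) (auto simp: norm_minus_commute)
    ultimately have "q y + t * (v \<bullet> (x - y))
        \<le> (1 - t) * q y + t * q x - H * (1 - t) * t * (norm (x - y))\<^sup>2"
      by (simp add: algebra_simps)
    then have "t * (q y + v \<bullet> (x - y) + H * (1 - t) * (norm (x - y))\<^sup>2) \<le> t * q x"
      by (simp add: algebra_simps)
    with t show ?thesis
      by simp
  qed
  then have ev: "\<forall>\<^sub>F t in at_right 0. q y + v \<bullet> (x - y) + H * (1 - t) * (norm (x - y))\<^sup>2 \<le> q x"
    by (intro eventually_at_rightI[of 0 1]) auto
  have lim: "((\<lambda>t. q y + v \<bullet> (x - y) + H * (1 - t) * (norm (x - y))\<^sup>2)
      \<longlongrightarrow> q y + v \<bullet> (x - y) + H * (1 - 0) * (norm (x - y))\<^sup>2) (at_right 0)"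
    by (intro tendsto_intros)
  from tendsto_upperbound[OF lim ev] show ?thesis
    by (simp add: H_def)
qed

text \<open>
  Minimizing the quadratic minorant \<open>v \<bullet> h + L / 2 * (norm h)\<^sup>2\<close> of the increment over \<open>h = x - y\<close>
  costs at most \<open>(norm v)\<^sup>2 / (2 * L)\<close> for each subgradient \<open>v\<close>. Read as a lower bound on
  \<open>norm v\<close>, this passes directly to the infimum over all subgradients, so that a subgradient of
  minimal norm need not be produced.
\<close>

lemma strongly_convex_inexact_minimizer:
  fixes q :: "'a::euclidean_space \<Rightarrow> real"
  assumes q: "convex_on X (\<lambda>x. q x - L / 2 * (norm (x - c))\<^sup>2)" and L: "L > 0"
    and D: "subdifferential (\<lambda>x. ereal (q x) + indicator_fun X x) y \<noteq> {}"
    and d: "infdist 0 (subdifferential (\<lambda>x. ereal (q x) + indicator_fun X x) y) \<le> d"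
    and y: "y \<in> X" and x: "x \<in> X"
  shows "q y - d\<^sup>2 / (2 * L) \<le> q x"
proof -
  let ?D = "subdifferential (\<lambda>x. ereal (q x) + indicator_fun X x) y"
  have "sqrt (2 * L * (q y - q x)) \<le> norm v" if v: "v \<in> ?D" for v
  proof -
    \<comment> \<open>The square completed here vanishes at the minimizer \<open>h = - v / L\<close> of the minorant.\<close>
    have "0 \<le> (norm (v + L *\<^sub>R (x - y)))\<^sup>2"
      by simp
    also have "\<dots> = (norm v)\<^sup>2 + 2 * L * (v \<bullet> (x - y)) + L\<^sup>2 * (norm (x - y))\<^sup>2"
      unfolding power2_norm_eq_inner
      by (simp add: inner_add_left inner_add_right inner_commute power2_eq_square algebra_simps)
    also have "\<dots> = (norm v)\<^sup>2 + 2 * L * (v \<bullet> (x - y) + L / 2 * (norm (x - y))\<^sup>2)"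
      by (simp add: power2_eq_square algebra_simps)
    also have "\<dots> \<le> (norm v)\<^sup>2 + 2 * L * (q x - q y)"
      using strongly_convex_subgradient_bound[OF q v y x] L by (intro add_left_mono mult_left_mono) auto
    finally show ?thesis
      by (intro real_le_lsqrt) (auto simp: algebra_simps)
  qed
  then have "sqrt (2 * L * (q y - q x)) \<le> infdist 0 ?D"
    using D unfolding infdist_notempty[OF D] by (intro cINF_greatest) auto
  with d have "sqrt (2 * L * (q y - q x)) \<le> d"
    by simp
  then have "2 * L * (q y - q x) \<le> d\<^sup>2"
    by (rule sqrt_le_D)
  with L show ?thesis
    by (simp add: field_simps)
qed

section \<open>The convex model\<close>

lemma psi_max_ge:
  assumes "j \<in> {1..npsi P i}"
  shows "psi P i j x \<le> psi_max P i x"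
  unfolding psi_max_def using assms by (intro Max_ge) auto

text \<open>
  In each component \<open>phi_hat\<close> dominates \<open>phi\<close> by the descent lemma, and the tangent to
  \<open>psi P i k\<close> lies below \<open>psi P i k\<close>, hence below the maximum \<open>psi_max P i\<close>. The penalty is
  monotone in the constraint values.
\<close>

lemma penalized_le_model:
  assumes X: "convex (feas P)" "feas P \<subseteq> nbhd P"
    and phi: "\<And>i. i \<le> ncon P \<Longrightarrow> cont_diff_on (nbhd P) (phi P i)"
    and psi: "\<And>i j. i \<le> ncon P \<Longrightarrow> j \<in> {1..npsi P i} \<Longrightarrow>
           convex_fun_on (nbhd P) (psi P i j) \<and> cont_diff_on (nbhd P) (psi P i j)"
    and lip: "\<And>i x y. i \<le> ncon P \<Longrightarrow> x \<in> feas P \<Longrightarrow> y \<in> feas P \<Longrightarrow>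
           norm (grad (phi P i) x - grad (phi P i) y) \<le> lip P i * norm (x - y)"
    and p: "p \<ge> 1" and \<rho>: "\<rho> > 0"
    and jj: "j0 \<in> {1..npsi P 0}" "\<And>i. i \<in> {1..ncon P} \<Longrightarrow> j i \<in> {1..npsi P i}"
    and c: "c \<in> feas P" and x: "x \<in> feas P"
  shows "penalized P p \<rho> x \<le> model P p \<rho> c (j0, j) x"
proof -
  have comp: "phi P i x + zeta P i x - psi_max P i x
      \<le> phi_hat P i c x + zeta P i x - lin (psi P i k) c x"
    if i: "i \<le> ncon P" and k: "k \<in> {1..npsi P i}" for i k
  proof -
    have "phi P i x \<le> phi_hat P i c x"
      using descent_lemma[OF X phi[OF i] lip[OF i] c x] by (simp add: phi_hat_def lin_def)
    moreover have "lin (psi P i k) c x \<le> psi P i k x"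
      using psi[OF i k] X c x closed_segment_subset[of c "feas P" x]
      by (intro lin_le_of_convex_fun_on[of "nbhd P"]) auto
    moreover note psi_max_ge[OF k, of x]
    ultimately show ?thesis
      by linarith
  qed
  have "(\<Sum>i = 1..ncon P. max (phi P i x + zeta P i x - psi_max P i x) 0 powr p)
      \<le> (\<Sum>i = 1..ncon P. max (phi_hat P i c x + zeta P i x - lin (psi P i (j i)) c x) 0 powr p)"
  proof (rule sum_mono)
    fix i assume i: "i \<in> {1..ncon P}"
    with comp[of i "j i"] jj(2)[OF i] p
    show "max (phi P i x + zeta P i x - psi_max P i x) 0 powr p
        \<le> max (phi_hat P i c x + zeta P i x - lin (psi P i (j i)) c x) 0 powr p"
      by (intro powr_mono2 max.mono) auto
  qed
  then show ?thesis
    using comp[OF _ jj(1)] \<rho> unfolding penalized_def model_def obj_def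
    by (simp add: add_mono mult_left_mono)
qed

text \<open>
  Subtracting the quadratic removes exactly the curvature of \<open>phi_hat P 0\<close>. What remains is an
  affine function plus \<open>zeta P 0\<close> plus the penalty, which is convex because each model constraint is
  convex and \<open>max _ 0 powr p\<close> preserves convexity.
\<close>

lemma convex_on_model_minus_quadratic:
  assumes X: "convex (feas P)"
    and zeta: "\<And>i. i \<le> ncon P \<Longrightarrow> convex_on (feas P) (zeta P i)"
    and L: "\<And>i. i \<le> ncon P \<Longrightarrow> lip P i \<ge> 0"
    and p: "p \<ge> 1" and \<rho>: "\<rho> > 0"
  shows "convex_on (feas P) (\<lambda>x. model P p \<rho> c jj x - lip P 0 / 2 * (norm (x - c))\<^sup>2)"
proof -
  obtain j0 j where jj: "jj = (j0, j)"
    by (cases jj)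
  have affine: "convex_on (feas P) (\<lambda>x. a + v \<bullet> (x - c) + zeta P i x)"
    if "i \<le> ncon P" for a v i
    using X zeta[OF that] by (intro convex_on_add convex_on_inner_right) (auto simp: convex_on_const)
  have con: "convex_on (feas P) (\<lambda>x. phi_hat P i c x + zeta P i x - lin (psi P i k) c x)"
    if i: "i \<le> ncon P" for i k
  proof -
    have "convex_on (feas P) (\<lambda>x. (phi P i c - psi P i k c)
        + (grad (phi P i) c - grad (psi P i k) c) \<bullet> (x - c) + zeta P i x
        + lip P i / 2 * (norm (x - c))\<^sup>2)"
      using L[OF i] X by (intro convex_on_add affine i convex_on_cmul convex_on_norm_diff_squared) auto
    then show ?thesis
      by (simp add: phi_hat_def lin_def inner_diff_left algebra_simps)
  qed
  have "convex_on (feas P) (\<lambda>x. (phi P 0 c - psi P 0 j0 c)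
      + (grad (phi P 0) c - grad (psi P 0 j0) c) \<bullet> (x - c) + zeta P 0 x
      + \<rho> * (\<Sum>i = 1..ncon P.
          max (phi_hat P i c x + zeta P i x - lin (psi P i (j i)) c x) 0 powr p))"
    using \<rho> X p
    by (intro convex_on_add affine convex_on_cmul convex_on_sum_fun convex_on_pos_part_powr con) auto
  moreover have "model P p \<rho> c jj x - lip P 0 / 2 * (norm (x - c))\<^sup>2 = (phi P 0 c - psi P 0 j0 c)
      + (grad (phi P 0) c - grad (psi P 0 j0) c) \<bullet> (x - c) + zeta P 0 x
      + \<rho> * (\<Sum>i = 1..ncon P.
          max (phi_hat P i c x + zeta P i x - lin (psi P i (j i)) c x) 0 powr p)" for x
    unfolding jj model_def
    by (simp add: phi_hat_def[of P 0] lin_def[of "psi P 0 j0"] inner_diff_left)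
  ultimately show ?thesis
    by (simp only:)
qed

section \<open>Runs of the algorithm\<close>

text \<open>
  The last conjunct is the energy bound: \<open>\<eta>\<close> is paid for every accepted step, up to the accumulated
  tolerances. The conjuncts on \<open>trial\<close> keep what the stopping state must deliver, namely one
  rejected approximate solution for each tried index pair.
\<close>

definition sca_invariant ::
  "('a::euclidean_space) dc_data \<Rightarrow> real \<Rightarrow> real \<Rightarrow> real \<Rightarrow> real \<Rightarrow> (nat \<Rightarrow> real) \<Rightarrow> 'a \<Rightarrow>
   'a sca_state \<Rightarrow> bool"
where
  "sca_invariant P p \<rho> \<eta> \<epsilon> \<delta> x0 s \<longleftrightarrow>
     point s \<in> feas P \<and>
     tried s \<subseteq> J0_eps P \<epsilon> (point s) \<times> J_eps P \<epsilon> (point s) \<and>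
     dom (trial s) = tried s \<and>
     (\<forall>jj y. trial s jj = Some y \<longrightarrow>
        approx_sol P p \<rho> (\<delta> (counter s)) (point s) jj y \<and>
        penalized P p \<rho> (point s) - penalized P p \<rho> y
          + (\<delta> (counter s))\<^sup>2 / (2 * lip P 0) \<le> \<eta>) \<and>
     penalized P p \<rho> (point s) + real (counter s) * \<eta>
       \<le> penalized P p \<rho> x0 + (\<Sum>t<counter s. (\<delta> t)\<^sup>2 / (2 * lip P 0))"

lemma sca_invariant_init:
  assumes "x0 \<in> feas P"
  shows "sca_invariant P p \<rho> \<eta> \<epsilon> \<delta> x0 (sca_init x0)"
  using assms by (simp add: sca_invariant_def sca_init_def)

lemma sca_invariant_step:
  assumes "sca_step P p \<rho> \<eta> \<epsilon> \<delta> s s'" "sca_invariant P p \<rho> \<eta> \<epsilon> \<delta> x0 s"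
  shows "sca_invariant P p \<rho> \<eta> \<epsilon> \<delta> x0 s'"
  using assms
proof (cases rule: sca_step.cases)
  case (accept jj x B t y T)
  then show ?thesis
    using assms(2) by (auto simp: sca_invariant_def approx_sol_def algebra_simps)
next
  case (reject jj x B t y T)
  then show ?thesis
    using assms(2) by (auto simp: sca_invariant_def)
qed

lemma sca_execution_invariant:
  assumes "sca_execution P p \<rho> \<eta> \<epsilon> \<delta> x0 \<sigma>" "x0 \<in> feas P"
  shows "sca_invariant P p \<rho> \<eta> \<epsilon> \<delta> x0 (\<sigma> k)"
proof (induction k)
  case 0
  then show ?case
    using assms by (simp add: sca_execution_def sca_invariant_init)
next
  case (Suc k)
  then show ?case
    using assms(1) unfolding sca_execution_def by (metis sca_invariant_step)
qed

lemma sca_invariant_counter_bounded: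
  assumes \<eta>: "\<eta> > 0" and L: "lip P 0 > 0"
    and \<delta>: "summable (\<lambda>t. (\<delta> t)\<^sup>2)" and bdd: "bdd_below (penalized P p \<rho> ` feas P)"
  obtains N where "\<And>s. sca_invariant P p \<rho> \<eta> \<epsilon> \<delta> x0 s \<Longrightarrow> counter s \<le> N"
proof -
  obtain m where m: "\<And>x. x \<in> feas P \<Longrightarrow> m \<le> penalized P p \<rho> x"
    using bdd unfolding bdd_below_def by auto
  define C where "C = penalized P p \<rho> x0 + (\<Sum>t. (\<delta> t)\<^sup>2 / (2 * lip P 0)) - m"
  have "counter s \<le> nat \<lceil>C / \<eta>\<rceil>" if s: "sca_invariant P p \<rho> \<eta> \<epsilon> \<delta> x0 s" for s
  proof -
    have "(\<Sum>t<counter s. (\<delta> t)\<^sup>2 / (2 * lip P 0)) \<le> (\<Sum>t. (\<delta> t)\<^sup>2 / (2 * lip P 0))"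
      using \<delta> L by (intro sum_le_suminf summable_divide) auto
    with s m[of "point s"] have "real (counter s) * \<eta> \<le> C"
      unfolding sca_invariant_def C_def by auto
    with \<eta> have "real (counter s) \<le> C / \<eta>"
      by (simp add: field_simps)
    then show ?thesis
      by linarith
  qed
  then show thesis
    by (rule that)
qed

lemma card_tried_le:
  assumes "sca_invariant P p \<rho> \<eta> \<epsilon> \<delta> x0 s"
  shows "finite (tried s)"
    and "card (tried s) \<le> card ({1..npsi P 0} \<times> PiE {1..ncon P} (\<lambda>i. {1..npsi P i}))"
proof -
  let ?A = "{1..npsi P 0} \<times> PiE {1..ncon P} (\<lambda>i. {1..npsi P i})"
  have sub: "tried s \<subseteq> ?A"
    using assms unfolding sca_invariant_def J0_eps_def J_eps_def by blast
  have fin: "finite ?A"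
    by (intro finite_cartesian_product finite_PiE) auto
  show "finite (tried s)"
    using sub fin by (rule finite_subset)
  show "card (tried s) \<le> card ?A"
    using fin sub by (rule card_mono)
qed

text \<open>
  An acceptance increases the counter, which is bounded by the energy, and empties the set of tried
  pairs; a rejection keeps the counter and enlarges that set, whose cardinality is bounded. The
  bound used for the cardinality is the number of all index pairs, which is the same at every iterate.
\<close>

lemma sca_execution_stops:
  assumes exec: "sca_execution P p \<rho> \<eta> \<epsilon> \<delta> x0 \<sigma>" and x0: "x0 \<in> feas P"
    and \<eta>: "\<eta> > 0" and L: "lip P 0 > 0"
    and \<delta>: "summable (\<lambda>t. (\<delta> t)\<^sup>2)" and bdd: "bdd_below (penalized P p \<rho> ` feas P)"
  obtains k where "sca_stopped P \<epsilon> (\<sigma> k)"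
proof (rule ccontr)
  assume "\<not> thesis"
  with that have "\<not> sca_stopped P \<epsilon> (\<sigma> k)" for k
    by blast
  with exec have step: "sca_step P p \<rho> \<eta> \<epsilon> \<delta> (\<sigma> k) (\<sigma> (Suc k))" for k
    by (simp add: sca_execution_def)
  have inv: "sca_invariant P p \<rho> \<eta> \<epsilon> \<delta> x0 (\<sigma> k)" for k
    using exec x0 by (rule sca_execution_invariant)
  obtain N where N: "\<And>s. sca_invariant P p \<rho> \<eta> \<epsilon> \<delta> x0 s \<Longrightarrow> counter s \<le> N"
    using sca_invariant_counter_bounded[OF \<eta> L \<delta> bdd] by blast
  define K where "K = card ({1..npsi P 0} \<times> PiE {1..ncon P} (\<lambda>i. {1..npsi P i}))"
  let ?R = "measures [\<lambda>s :: 'a sca_state. N - counter s, \<lambda>s. K - card (tried s)]"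
  have "(\<sigma> (Suc k), \<sigma> k) \<in> ?R" for k
    using step[of k]
  proof (cases rule: sca_step.cases)
    case (accept jj x B t y T)
    then show ?thesis
      using N[OF inv[of "Suc k"]] by auto
  next
    case (reject jj x B t y T)
    then show ?thesis
      using card_tried_le[OF inv[of k]] card_tried_le[OF inv[of "Suc k"]] by (auto simp: K_def)
  qed
  moreover have "wf ?R"
    by simp
  ultimately show False
    by (auto simp: wf_iff_no_infinite_down_chain)
qed

section \<open>The state in which the algorithm stops\<close>

theorem theorem5p1:
  fixes P :: "('a::euclidean_space) dc_data"
    and p \<rho> \<eta> \<epsilon> :: real
    and \<delta> :: "nat \<Rightarrow> real"
    and x0 :: 'a
    and \<sigma> :: "nat \<Rightarrow> 'a sca_state"
  assumes "closed (feas P)" and "convex (feas P)"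
    and "open (nbhd P)" and "feas P \<subseteq> nbhd P"
    and "\<And>i. i \<le> ncon P \<Longrightarrow> npsi P i \<ge> 1"
    and "\<And>i. i \<le> ncon P \<Longrightarrow> convex_fun_on (nbhd P) (zeta P i) \<and> continuous_on (nbhd P) (zeta P i)"
    and "\<And>i. i \<le> ncon P \<Longrightarrow> convex_fun_on (nbhd P) (phi P i) \<and> cont_diff_on (nbhd P) (phi P i)"
    and "\<And>i j. i \<le> ncon P \<Longrightarrow> j \<in> {1..npsi P i} \<Longrightarrow>
           convex_fun_on (nbhd P) (psi P i j) \<and> cont_diff_on (nbhd P) (psi P i j)"
    and "\<And>i x y. i \<le> ncon P \<Longrightarrow> x \<in> feas P \<Longrightarrow> y \<in> feas P \<Longrightarrow>
           norm (grad (phi P i) x - grad (phi P i) y) \<le> lip P i * norm (x - y)"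
    and "\<And>i. i \<le> ncon P \<Longrightarrow> lip P i \<ge> 0" and "lip P 0 > 0"
    and "\<And>i. i \<in> {1..ncon P} \<Longrightarrow> \<exists>a b. \<forall>x \<in> nbhd P. phi P i x = a \<bullet> x + b \<Longrightarrow> lip P i = 0"
    and "p \<ge> 1" and "\<rho> > 0"
    and "x0 \<in> feas P" and "\<eta> > 0" and "\<epsilon> > 0"
    and "\<And>t. \<delta> t \<ge> 0" and "summable (\<lambda>t. (\<delta> t)\<^sup>2)"
    and "bdd_below (penalized P p \<rho> ` feas P)"
    and "sca_execution P p \<rho> \<eta> \<epsilon> \<delta> x0 \<sigma>"
  shows "\<exists>k t xt B T.
     \<sigma> k = \<lparr>counter = t, point = xt, tried = B, trial = T\<rparr> \<and>
     sca_stopped P \<epsilon> (\<sigma> k) \<and>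
     (\<forall>j0 \<in> J0_eps P \<epsilon> xt. \<forall>j \<in> J_eps P \<epsilon> xt.
        \<exists>y. T (j0, j) = Some y \<and>
            penalized P p \<rho> xt - penalized P p \<rho> y + (\<delta> t)\<^sup>2 / (2 * lip P 0) \<le> \<eta>) \<and>
     (\<forall>j0 \<in> J0_eps P \<epsilon> xt. \<forall>j \<in> J_eps P \<epsilon> xt. \<forall>x \<in> feas P.
        penalized P p \<rho> xt \<le> model P p \<rho> xt (j0, j) x + \<eta>)"
proof -
  obtain k where stop: "sca_stopped P \<epsilon> (\<sigma> k)"
    using sca_execution_stops[OF assms(21) assms(15) assms(16) assms(11) assms(19) assms(20)] .
  obtain t xt B T where k: "\<sigma> k = \<lparr>counter = t, point = xt, tried = B, trial = T\<rparr>"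
    by (metis sca_state.cases_scheme old.unit.exhaust)
  have inv: "xt \<in> feas P" "dom T = B"
    "\<And>jj y. T jj = Some y \<Longrightarrow> approx_sol P p \<rho> (\<delta> t) xt jj y"
    "\<And>jj y. T jj = Some y \<Longrightarrow>
      penalized P p \<rho> xt - penalized P p \<rho> y + (\<delta> t)\<^sup>2 / (2 * lip P 0) \<le> \<eta>"
    using sca_execution_invariant[OF assms(21) assms(15), of k] unfolding sca_invariant_def k by auto
  have B: "B = J0_eps P \<epsilon> xt \<times> J_eps P \<epsilon> xt"
    using stop by (simp add: sca_stopped_def k)
  have zeta: "convex_on (feas P) (zeta P i)" if "i \<le> ncon P" for i
  proof -
    have "convex_fun_on (feas P) (zeta P i)"
      using assms(4) assms(6)[OF that] unfolding convex_fun_on_def by blast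
    with assms(2) show ?thesis
      by (simp add: convex_fun_on_iff_convex_on)
  qed
  have trial: "\<exists>y. T (j0, j) = Some y \<and>
        penalized P p \<rho> xt - penalized P p \<rho> y + (\<delta> t)\<^sup>2 / (2 * lip P 0) \<le> \<eta>"
    if "j0 \<in> J0_eps P \<epsilon> xt" "j \<in> J_eps P \<epsilon> xt" for j0 j
    using that inv B by blast
  have "penalized P p \<rho> xt \<le> model P p \<rho> xt (j0, j) x + \<eta>"
    if j: "j0 \<in> J0_eps P \<epsilon> xt" "j \<in> J_eps P \<epsilon> xt" and x: "x \<in> feas P" for j0 j x
  proof -
    obtain y where y: "T (j0, j) = Some y"
      and dec: "penalized P p \<rho> xt - penalized P p \<rho> y + (\<delta> t)\<^sup>2 / (2 * lip P 0) \<le> \<eta>"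
      using trial[OF j] by blast
    from inv(3)[OF y] have yX: "y \<in> feas P"
      and D: "subdifferential (\<lambda>x. ereal (model P p \<rho> xt (j0, j) x) + indicator_fun (feas P) x) y \<noteq> {}"
      and d: "infdist 0 (subdifferential
        (\<lambda>x. ereal (model P p \<rho> xt (j0, j) x) + indicator_fun (feas P) x) y) \<le> \<delta> t"
      by (auto simp: approx_sol_def Let_def)
    have "model P p \<rho> xt (j0, j) y - (\<delta> t)\<^sup>2 / (2 * lip P 0) \<le> model P p \<rho> xt (j0, j) x"
      using strongly_convex_inexact_minimizer[OF
          convex_on_model_minus_quadratic[OF assms(2) zeta assms(10) assms(13) assms(14)]
          assms(11) D d yX x] .
    moreover have "penalized P p \<rho> y \<le> model P p \<rho> xt (j0, j) y"
      using j assms(7) unfolding J0_eps_def J_eps_def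
      by (intro penalized_le_model[OF assms(2) assms(4) _ assms(8) assms(9) assms(13) assms(14)
            _ _ inv(1) yX]) (auto simp: PiE_def Pi_def)
    ultimately show ?thesis
      using dec by linarith
  qed
  with stop k trial show ?thesis
    by blast
qed

end
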